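(* Let $m\ge2$, $\rho\ge\frac{m^m}{(m-1)^{m-1}}$ and a budget $T$ be given. An optimal strategy for Maximum Clearance on the $m$-ray star, i.e., a point of maximum objective value among all feasible points of $P_m^{(k)}$ over all $k\ge m$, can be computed in time $O(m\log(T)\log(m\log(T)))$.
   Context: For $k\ge m$, $P_m^{(k)}$ is the linear program in real variables $x_1,\dots,x_k$: maximize $\sum_{i=0}^{m-1}x_{k-i}$ subject to $(C_0)$: $\sum_{i=1}^{m-1}x_i\le\rho$; $(C_j)$: $\sum_{i=1}^{j+m-1}x_i\le\rho\,x_j$ for $j\in[1,k-m]$; $(E_j)$: $\sum_{i=1}^k x_i\le\rho\,x_j$ for $j\in[k-m+1,k-1]$; $(M_i)$: $x_i\le x_{i+1}$ for $i\in[1,k-1]$; $(B)$: $2\sum_{i=1}^{k-1}x_i+x_k\le T$. A feasible point represents a cyclic strategy on $m$ rays meeting at a root (step $i$ searches ray $i\bmod m$ to distance $x_i$ and returns) that is $(1+2\rho)$-competitive (competitive ratio = supremum over target positions at distance $\ge1$ of search time divided by target distance), extendable, and within time budget $T$; the objective is the total cleared length. *)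

theory Defs
  imports Complex_Main
begin

section \<open>The linear program and optimal strategies\<close>

text \<open>
  A strategy with \<open>k\<close> steps is a function \<open>x :: nat \<Rightarrow> real\<close>, of which only the values
  \<open>x 1, \<dots>, x k\<close> matter. The constraints after \<open>k \<ge> m\<close> are: competitiveness for targets at
  distance 1 and just beyond \<open>x j\<close>, extendability, monotonicity, and the time budget.
  Natural number subtraction is not truncated for \<open>k \<ge> m \<ge> 1\<close>.
\<close>

definition feasible :: "nat \<Rightarrow> real \<Rightarrow> real \<Rightarrow> nat \<Rightarrow> (nat \<Rightarrow> real) \<Rightarrow> bool" where
  "feasible m \<rho> T k x \<longleftrightarrow>
     k \<ge> m \<and>
     (\<Sum>i = 1..m - 1. x i) \<le> \<rho> \<and>
     (\<forall>j \<in> {1..k - m}. (\<Sum>i = 1..j + m - 1. x i) \<le> \<rho> * x j) \<and>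
     (\<forall>j \<in> {k - m + 1..k - 1}. (\<Sum>i = 1..k. x i) \<le> \<rho> * x j) \<and>
     (\<forall>i \<in> {1..k - 1}. x i \<le> x (i + 1)) \<and>
     2 * (\<Sum>i = 1..k - 1. x i) + x k \<le> T"

definition clearance :: "nat \<Rightarrow> nat \<Rightarrow> (nat \<Rightarrow> real) \<Rightarrow> real" where
  "clearance m k x = (\<Sum>i = 0..m - 1. x (k - i))"

definition optimal_strategy :: "nat \<Rightarrow> real \<Rightarrow> real \<Rightarrow> nat \<Rightarrow> (nat \<Rightarrow> real) \<Rightarrow> bool" where
  "optimal_strategy m \<rho> T k x \<longleftrightarrow>
     feasible m \<rho> T k x \<and>
     (\<forall>k' y. feasible m \<rho> T k' y \<longrightarrow> clearance m k' y \<le> clearance m k x)"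


section \<open>A real RAM\<close>

text \<open>
  The memory consists of arrays of natural numbers (used for counting and addressing) and arrays of
  reals; a scalar register is cell 0 of an array. Array names are constants of the program text and
  cell numbers are computed, so addressing is indirect. Exact real arithmetic and
  comparisons have unit cost. There is no operation that turns a real into a natural number
  (rounding in constant time would make the model unreasonably powerful), natural numbers have no
  multiplication, and programs contain no real constants, so that no uncomputable real can be
  hard-wired into a program.
\<close>

datatype nexp =
    NConst nat
  | NGet nat nexp
  | NAdd nexp nexp
  | NSub nexp nexp
  | NHalf nexp

datatype rexp =
    ROf nexp
  | RGet nat nexp
  | RAdd rexp rexp
  | RSub rexp rexp
  | RMul rexp rexp
  | RDiv rexp rexp

datatype bexp =
    NLess nexp nexp
  | RLess rexp rexp
  | BNot bexp
  | BAnd bexp bexp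

datatype com =
    Skip
  | NSet nat nexp nexp
  | RSet nat nexp rexp
  | Seq com com
  | If bexp com com
  | While bexp com

record memory =
  nats :: "nat \<Rightarrow> nat \<Rightarrow> nat"
  reals :: "nat \<Rightarrow> nat \<Rightarrow> real"

text \<open>
  \<open>NSub\<close> truncates at 0 and \<open>RDiv\<close> by 0 yields 0. The latter is harmless, since a program can
  test the divisor first.
\<close>

primrec nval :: "nexp \<Rightarrow> memory \<Rightarrow> nat" where
  "nval (NConst n) s = n"
| "nval (NGet a e) s = nats s a (nval e s)"
| "nval (NAdd e f) s = nval e s + nval f s"
| "nval (NSub e f) s = nval e s - nval f s"
| "nval (NHalf e) s = nval e s div 2"

primrec rval :: "rexp \<Rightarrow> memory \<Rightarrow> real" where
  "rval (ROf e) s = real (nval e s)"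
| "rval (RGet a e) s = reals s a (nval e s)"
| "rval (RAdd e f) s = rval e s + rval f s"
| "rval (RSub e f) s = rval e s - rval f s"
| "rval (RMul e f) s = rval e s * rval f s"
| "rval (RDiv e f) s = rval e s / rval f s"

primrec bval :: "bexp \<Rightarrow> memory \<Rightarrow> bool" where
  "bval (NLess e f) s \<longleftrightarrow> nval e s < nval f s"
| "bval (RLess e f) s \<longleftrightarrow> rval e s < rval f s"
| "bval (BNot b) s \<longleftrightarrow> \<not> bval b s"
| "bval (BAnd b c) s \<longleftrightarrow> bval b s \<and> bval c s"

text \<open>Evaluating an expression costs one unit per operation, memory access or constant in it.\<close>

primrec ncost :: "nexp \<Rightarrow> nat" where
  "ncost (NConst n) = 1"
| "ncost (NGet a e) = ncost e + 1"
| "ncost (NAdd e f) = ncost e + ncost f + 1"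
| "ncost (NSub e f) = ncost e + ncost f + 1"
| "ncost (NHalf e) = ncost e + 1"

primrec rcost :: "rexp \<Rightarrow> nat" where
  "rcost (ROf e) = ncost e + 1"
| "rcost (RGet a e) = ncost e + 1"
| "rcost (RAdd e f) = rcost e + rcost f + 1"
| "rcost (RSub e f) = rcost e + rcost f + 1"
| "rcost (RMul e f) = rcost e + rcost f + 1"
| "rcost (RDiv e f) = rcost e + rcost f + 1"

primrec bcost :: "bexp \<Rightarrow> nat" where
  "bcost (NLess e f) = ncost e + ncost f + 1"
| "bcost (RLess e f) = rcost e + rcost f + 1"
| "bcost (BNot b) = bcost b + 1"
| "bcost (BAnd b c) = bcost b + bcost c + 1"

definition nset :: "nat \<Rightarrow> nat \<Rightarrow> nat \<Rightarrow> memory \<Rightarrow> memory" where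
  "nset a i v s = s\<lparr>nats := (nats s)(a := (nats s a)(i := v))\<rparr>"

definition rset :: "nat \<Rightarrow> nat \<Rightarrow> real \<Rightarrow> memory \<Rightarrow> memory" where
  "rset a i v s = s\<lparr>reals := (reals s)(a := (reals s a)(i := v))\<rparr>"

text \<open>\<open>exec c s t s'\<close>: started in \<open>s\<close>, the program \<open>c\<close> halts in \<open>s'\<close> after exactly \<open>t\<close> time units.\<close>

inductive exec :: "com \<Rightarrow> memory \<Rightarrow> nat \<Rightarrow> memory \<Rightarrow> bool" where
  Skip: "exec Skip s 1 s"
| NSet: "exec (NSet a i e) s (ncost i + ncost e + 1) (nset a (nval i s) (nval e s) s)"
| RSet: "exec (RSet a i e) s (ncost i + rcost e + 1) (rset a (nval i s) (rval e s) s)"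
| Seq: "exec c s t s' \<Longrightarrow> exec d s' u s'' \<Longrightarrow> exec (Seq c d) s (t + u) s''"
| IfTrue: "bval b s \<Longrightarrow> exec c s t s' \<Longrightarrow> exec (If b c d) s (bcost b + t) s'"
| IfFalse: "\<not> bval b s \<Longrightarrow> exec d s t s' \<Longrightarrow> exec (If b c d) s (bcost b + t) s'"
| WhileFalse: "\<not> bval b s \<Longrightarrow> exec (While b c) s (bcost b) s"
| WhileTrue: "bval b s \<Longrightarrow> exec c s t s' \<Longrightarrow> exec (While b c) s' u s''
    \<Longrightarrow> exec (While b c) s (bcost b + t + u) s''"

inductive_cases exec_SkipE: "exec Skip s t s'"
inductive_cases exec_NSetE: "exec (NSet a i e) s t s'"
inductive_cases exec_RSetE: "exec (RSet a i e) s t s'"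
inductive_cases exec_SeqE: "exec (Seq c d) s t s'"
inductive_cases exec_IfE: "exec (If b c d) s t s'"
inductive_cases exec_WhileE: "exec (While b c) s t s'"

lemma exec_deterministic:
  "exec c s t s' \<Longrightarrow> exec c s u s'' \<Longrightarrow> u = t \<and> s'' = s'"
proof (induction arbitrary: u s'' rule: exec.induct)
  case (Skip s)
  then show ?case by (auto elim: exec_SkipE)
next
  case (NSet a i e s)
  then show ?case by (auto elim: exec_NSetE)
next
  case (RSet a i e s)
  then show ?case by (auto elim: exec_RSetE)
next
  case (Seq c s t s' d u s'')
  from Seq.prems show ?case by (rule exec_SeqE) (use Seq.IH in blast)
next
  case (IfTrue b s c t s' d)
  from IfTrue.prems show ?case by (rule exec_IfE) (use IfTrue in blast)+
next
  case (IfFalse b s d t s' c)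
  from IfFalse.prems show ?case by (rule exec_IfE) (use IfFalse in blast)+
next
  case (WhileFalse b s c)
  from WhileFalse.prems show ?case by (rule exec_WhileE) (use WhileFalse in blast)+
next
  case (WhileTrue b s c t s' u s'')
  from WhileTrue.prems show ?case by (rule exec_WhileE) (use WhileTrue in blast)+
qed

text \<open>
  Input: \<open>m\<close> is in cell 0 of natural array 0; \<open>\<rho>\<close> and \<open>T\<close> are in cells 0 and 1 of real array 0;
  everything else is 0. Output: the number \<open>k\<close> of steps is in cell 0 of natural array 0, and
  \<open>x 1, \<dots>, x k\<close> are in cells \<open>1, \<dots>, k\<close> of real array 0.
\<close>

definition input :: "nat \<Rightarrow> real \<Rightarrow> real \<Rightarrow> memory" where
  "input m \<rho> T =
     \<lparr>nats = (\<lambda>a i. if a = 0 \<and> i = 0 then m else 0),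
      reals = (\<lambda>a i. if a = 0 \<and> i = 0 then \<rho> else if a = 0 \<and> i = 1 then T else 0)\<rparr>"

definition output_steps :: "memory \<Rightarrow> nat" where
  "output_steps s = nats s 0 0"

definition output_strategy :: "memory \<Rightarrow> nat \<Rightarrow> real" where
  "output_strategy s i = reals s 0 i"

text \<open>
  For \<open>T \<ge> 2\<close> this is literally \<open>m log T log (m log T)\<close>. Below that \<open>log T\<close> tends to 0 and becomes
  negative, so, as usual for such bounds, \<open>T\<close> is replaced by 2. As \<open>m \<ge> 2\<close>, all factors are then
  at least 1.
\<close>

definition time_bound :: "nat \<Rightarrow> real \<Rightarrow> real" where
  "time_bound m T = (let L = real m * log 2 (max T 2) in L * log 2 L)"

end

theory Submission
  imports Defs
begin

text \<open>
  For fixed \<open>k\<close> and fixed total \<open>W\<close>, a discrete maximum principle shows that no feasible strategy has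
  smaller prefix sums than the strategy for which all competitiveness and extendability
  constraints are tight. Hence that strategy has the largest clearance, uses the least time and is
  the last to violate \<open>C\<^sub>0\<close>, so only the scaling \<open>W\<close> remains to be chosen: the largest one allowed by
  \<open>C\<^sub>0\<close> and the budget. Everything is expressed through the solution of
  \<open>h (n + 1) = h n - h (n + 1 - m) / \<rho>\<close> with impulsive start, which stays positive exactly because
  \<open>\<rho> \<ge> m\<^sup>m / (m - 1)\<^sup>m\<^sup>-\<^sup>1\<close>. The budget-limited optimum decreases with \<open>k\<close>, so one may try
  \<open>k = m, m + 1, \<dots>\<close>, at constant cost each, and stop as soon as the budget is the binding constraint.
  Comparison with the geometric strategy of ratio \<open>m / (m - 1)\<close> shows that this happens for some
  \<open>k = O(m log T)\<close>. This is even slightly faster than a binary search for \<open>k\<close>.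
\<close>

section \<open>The impulse response of the tight recurrence\<close>

text \<open>The leading \<open>m\<close> zeros let the delayed term vanish by itself at the start,
  so one recurrence serves from index \<open>m\<close> on. The guard \<open>m = 0\<close> secures
  termination.\<close>

fun impulse :: "nat \<Rightarrow> real \<Rightarrow> nat \<Rightarrow> real" where
  "impulse m \<rho> n =
     (if n < m then 0 else if n = m \<or> m = 0 then 1
      else impulse m \<rho> (n - 1) - impulse m \<rho> (n - m) / \<rho>)"

declare impulse.simps [simp del]

locale star =
  fixes m :: nat and \<rho> :: real
  assumes two_le_m: "2 \<le> m"
    and critical_le: "real m ^ m / real (m - 1) ^ (m - 1) \<le> \<rho>"
begin

abbreviation g :: "nat \<Rightarrow> real" where "g \<equiv> impulse m \<rho>"

lemma g_below: "n < m \<Longrightarrow> g n = 0"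
  by (simp add: impulse.simps)

lemma g_m: "g m = 1"
  by (simp add: impulse.simps)

lemma g_rec: "m \<le> n \<Longrightarrow> g (Suc n) = g n - g (Suc n - m) / \<rho>"
  using two_le_m by (simp add: impulse.simps[of m \<rho> "Suc n"])

text \<open>The minimiser of \<open>y ^ m / (y - 1)\<close> over \<open>y > 1\<close>; the minimum
  \<open>m * z ^ (m - 1)\<close> is the critical value of \<rho>. This is the ratio of the geometric
  strategy that tolerates the smallest \<rho>.\<close>

definition z :: real where "z = real m / real (m - 1)"

lemma z_gt_1: "1 < z"
  using two_le_m by (simp add: z_def field_simps of_nat_diff)

lemma z_diff: "(z - 1) * real m = z"
  using two_le_m by (simp add: z_def field_simps of_nat_diff)

lemma z_power_le: "real m * z ^ (m - 1) \<le> \<rho>"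
proof -
  have "real m * z ^ (m - 1) = real m ^ m / real (m - 1) ^ (m - 1)"
    using two_le_m power_Suc[of "real m" "m - 1"] by (simp add: z_def power_divide)
  then show ?thesis using critical_le by simp
qed

text \<open>Bernoulli's inequality. Doubling every \<open>m - 1\<close> steps is what makes O(m log
  T) steps suffice.\<close>

lemma two_le_z_power: "2 \<le> z ^ (m - 1)"
proof -
  have "1 + real (m - 1) * (1 / real (m - 1)) \<le> (1 + 1 / real (m - 1)) ^ (m - 1)"
    by (rule Bernoulli_inequality) (simp add: order_trans[of _ 0])
  moreover have "1 + 1 / real (m - 1) = z"
    using two_le_m by (simp add: z_def field_simps of_nat_diff)
  ultimately show ?thesis using two_le_m by simp
qed

lemma two_m_le_rho: "2 * real m \<le> \<rho>"
proof -
  have "real m * 2 \<le> real m * z ^ (m - 1)"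
    by (rule mult_left_mono[OF two_le_z_power]) simp
  then show ?thesis using z_power_le by simp
qed

lemma rho_ge_4: "4 \<le> \<rho>"
  using two_m_le_rho two_le_m by linarith

text \<open>Iterating the ratio bound back over \<open>m - 1\<close> indices gives
  \<open>g (n + 1 - m) \<le> z ^ (m - 1) * g n\<close>. As
  \<open>m * z ^ (m - 1) \<le> \<rho>\<close>, one step loses at most the fraction
  \<open>1 / m\<close> of \<open>g n\<close>, and \<open>1 - 1 / m = 1 / z\<close>. Positivity and
  ratio bound thus carry each other through the induction.\<close>

lemma g_pos_and_ratio:
  "m \<le> n \<Longrightarrow> 0 < g n \<and> g n \<le> z * g (Suc n)"
proof (induction n rule: less_induct)
  case (less n)
  have growth: "g (n - d) \<le> z ^ d * g n" if "d \<le> n - m" for d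
    using that
  proof (induction d)
    case (Suc d)
    have "g (n - Suc d) \<le> z * g (Suc (n - Suc d))"
      using less.IH[of "n - Suc d"] Suc.prems by simp
    also have "Suc (n - Suc d) = n - d" using Suc.prems by simp
    also have "z * g (n - d) \<le> z * (z ^ d * g n)"
      using Suc z_gt_1 by (intro mult_left_mono) auto
    finally show ?case by (simp add: mult_ac)
  qed simp
  have pos: "0 < g n"
  proof (cases "n = m")
    case False
    with less.prems have "0 < g (n - 1)" "g (n - 1) \<le> z * g n"
      using less.IH[of "n - 1"] by auto
    then have "0 < z * g n" by linarith
    then show ?thesis using z_gt_1 by (simp add: zero_less_mult_iff)
  qed (simp add: g_m)
  have "g (Suc n - m) \<le> z ^ (m - 1) * g n"
  proof (cases "2 * m - 1 \<le> n")
    case True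
    then have "Suc n - m = n - (m - 1)" "m - 1 \<le> n - m" using two_le_m by auto
    then show ?thesis using growth[of "m - 1"] by metis
  next
    case False
    then have "g (Suc n - m) = 0" using less.prems by (intro g_below) auto
    then show ?thesis using pos z_gt_1 by simp
  qed
  then have "real m * g (Suc n - m) \<le> (real m * z ^ (m - 1)) * g n"
    using mult_left_mono[of "g (Suc n - m)" "z ^ (m - 1) * g n" "real m"] by (simp add: mult.assoc)
  also have "\<dots> \<le> \<rho> * g n"
    using z_power_le pos by (intro mult_right_mono) auto
  finally have "g (Suc n - m) / \<rho> \<le> g n / real m"
    using rho_ge_4 two_le_m by (simp add: field_simps)
  then have "(1 - 1 / real m) * g n \<le> g (Suc n)"
    using g_rec[OF less.prems] by (simp add: algebra_simps)
  then have "z * ((1 - 1 / real m) * g n) \<le> z * g (Suc n)"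
    using z_gt_1 by (intro mult_left_mono) auto
  moreover have "z * (1 - 1 / real m) = 1"
    using two_le_m by (simp add: z_def field_simps of_nat_diff)
  ultimately show ?case using pos by (simp add: mult.assoc[symmetric])
qed

lemma g_pos: "m \<le> n \<Longrightarrow> 0 < g n"
  using g_pos_and_ratio by blast

lemma g_nonneg: "0 \<le> g n"
  using g_pos[of n] g_below[of n] by (cases "m \<le> n") auto

lemma g_Suc_le: "m \<le> n \<Longrightarrow> g (Suc n) \<le> g n"
  using g_rec[of n] divide_nonneg_pos[OF g_nonneg[of "Suc n - m"], of \<rho>] rho_ge_4 by simp

lemma g_le_add: "m \<le> n \<Longrightarrow> g n \<le> z ^ d * g (n + d)"
proof (induction d)
  case (Suc d)
  have "z ^ d * g (n + d) \<le> z ^ d * (z * g (Suc (n + d)))"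
    using g_pos_and_ratio[of "n + d"] Suc.prems z_gt_1 by (intro mult_left_mono) auto
  with Suc show ?case by (simp add: mult_ac)
qed simp

lemma g_add_le: "m \<le> n \<Longrightarrow> g (n + d) \<le> g n"
proof (induction d)
  case (Suc d)
  then show ?case using g_Suc_le[of "n + d"] by simp
qed simp

text \<open>The delayed term is still zero here. Read backwards, this is the stretch from
  \<open>k\<close> on where prefix sums equal the total.\<close>

lemma g_plateau: "m \<le> n \<Longrightarrow> n < 2 * m \<Longrightarrow> g n = 1"
proof (induction n rule: dec_induct)
  case (step n)
  then show ?case using g_rec[of n] g_below[of "Suc n - m"] by simp
qed (simp add: g_m)


section \<open>The tight strategies\<close>

text \<open>
  Differences of prefix sums satisfy the hypotheses; the conclusion is a discrete maximum
  principle, since a quotient that is nonnegative at 0 remains nonnegative.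
\<close>

lemma comparison:
  assumes rec: "\<And>n. Suc n < k \<Longrightarrow> D n \<le> D (Suc n) - D (n + m) / \<rho>"
    and tail: "\<And>n. k \<le> n \<Longrightarrow> n < k + m - 1 \<Longrightarrow> 0 \<le> D n"
  shows "i \<le> n \<Longrightarrow> n < k \<Longrightarrow> D i / g (k + m - 1 - i) \<le> D n / g (k + m - 1 - n)"
proof (induction "k - i" arbitrary: i n rule: less_induct)
  case less
  let ?E = "\<lambda>n. D n / g (k + m - 1 - n)"
  show ?case
  proof (cases "i = n")
    case False
    then have lt: "Suc i < k" "Suc i \<le> n" using less.prems by auto
    have IH: "?E (Suc i) \<le> ?E n'" if "Suc i \<le> n'" "n' < k" for n'
      using that lt by (intro less.hyps) auto
    have pos: "0 < g (k + m - 1 - n')" if "n' < k" for n'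
      using that by (intro g_pos) auto
    \<comment> \<open>\<open>g (k + m - 1 - n)\<close> solves the recurrence with equality, with
      delayed value \<open>g (k - 1 - n)\<close>. If \<open>i + m < k\<close>, the induction
      hypothesis reaches \<open>i + m\<close>; otherwise this value is zero and
      \<open>D (i + m)\<close> is nonnegative.\<close>
    have "?E (Suc i) * g (k - 1 - i) \<le> D (i + m)"
    proof (cases "i + m < k")
      case True
      have "?E (Suc i) \<le> ?E (i + m)" using True two_le_m by (intro IH) auto
      then show ?thesis using pos[OF True] True two_le_m
        by (auto simp: pos_le_divide_eq)
    next
      case False
      then have "g (k - 1 - i) = 0" using lt by (intro g_below) auto
      then show ?thesis using tail[of "i + m"] False lt by simp
    qed
    then have "?E (Suc i) * g (k - 1 - i) / \<rho> \<le> D (i + m) / \<rho>"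
      using rho_ge_4 by (intro divide_right_mono) auto
    moreover have "?E (Suc i) * g (k + m - 1 - Suc i) = D (Suc i)"
      using pos[OF lt(1)] by simp
    moreover have "g (k + m - 1 - i) = g (k + m - 1 - Suc i) - g (k - 1 - i) / \<rho>"
    proof -
      have "Suc (k + m - 1 - Suc i) = k + m - 1 - i" using lt by auto
      moreover have "k + m - 1 - i - m = k - 1 - i" by auto
      ultimately show ?thesis using g_rec[of "k + m - 1 - Suc i"] lt by simp
    qed
    ultimately have "D i \<le> ?E (Suc i) * g (k + m - 1 - i)"
      using rec[OF lt(1)] by (simp only: right_diff_distrib times_divide_eq_right)
    then have "?E i \<le> ?E (Suc i)"
      using pos[of i] lt by (simp only: pos_divide_le_eq Suc_lessD)
    also have "\<dots> \<le> ?E n" using lt less.prems by (intro IH) auto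
    finally show ?thesis .
  qed simp
qed

lemma comparison_nonneg:
  assumes rec: "\<And>n. Suc n < k \<Longrightarrow> D n \<le> D (Suc n) - D (n + m) / \<rho>"
    and tail: "\<And>n. k \<le> n \<Longrightarrow> n < k + m - 1 \<Longrightarrow> 0 \<le> D n"
    and "0 \<le> D 0" "n < k + m - 1"
  shows "0 \<le> D n"
proof (cases "n < k")
  case True
  then have pos: "0 < g (k + m - 1)" "0 < g (k + m - 1 - n)" by (intro g_pos; simp)+
  have "D 0 / g (k + m - 1 - 0) \<le> D n / g (k + m - 1 - n)"
    using comparison[of k D, OF rec tail] True by blast
  moreover have "0 \<le> D 0 / g (k + m - 1 - 0)" using assms(3) pos by simp
  ultimately have "0 \<le> D n / g (k + m - 1 - n)" by linarith
  then show ?thesis using pos by (simp add: zero_le_divide_iff)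
qed (use tail assms(4) in auto)

section \<open>Closed form of the tight strategies\<close>

definition last_ratio :: "nat \<Rightarrow> real" where
  "last_ratio k = g (k + 2 * m - 2) / g (k + m - 1)"

definition tight :: "nat \<Rightarrow> real \<Rightarrow> nat \<Rightarrow> real" where
  "tight k W j =
     (if j = k then W * last_ratio k
      else (W * g (k + m - 1 - j) - W * last_ratio k * g (k - j)) / \<rho>)"

text \<open>Prefix sums for total 1, continued by the constant 1 from \<open>k\<close> to
  \<open>k + m - 2\<close>, so that competitiveness and extendability become one recurrence. Both
  summands solve it, the first with value 1 on that stretch, the second with value 0;
  \<open>last_ratio k\<close> is the multiple that makes the result vanish at 0.\<close>

definition tight_prefix :: "nat \<Rightarrow> nat \<Rightarrow> real" where
  "tight_prefix k n = g (k + 2 * m - 2 - n) - last_ratio k * g (k + m - 1 - n)"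

lemma tight_prefix_0: "1 \<le> k \<Longrightarrow> tight_prefix k 0 = 0"
  using less_imp_neq[OF g_pos[of "k + m - 1"]] by (auto simp: tight_prefix_def last_ratio_def)

lemma tight_prefix_tail: "k \<le> n \<Longrightarrow> n < k + m - 1 \<Longrightarrow> tight_prefix k n = 1"
  using g_plateau[of "k + 2 * m - 2 - n"] g_below[of "k + m - 1 - n"] two_le_m
  by (simp add: tight_prefix_def)

lemma g_shift_rec:
  assumes "Suc n < k"
  shows "g (k + 2 * m - 2 - n) = g (k + 2 * m - 2 - Suc n) - g (k + 2 * m - 2 - (n + m)) / \<rho>"
    and "g (k + m - 1 - n) = g (k + m - 1 - Suc n) - g (k + m - 1 - (n + m)) / \<rho>"
proof -
  have "Suc (k + 2 * m - 2 - Suc n) = k + 2 * m - 2 - n"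
    "Suc (k + m - 1 - Suc n) = k + m - 1 - n" using assms two_le_m by auto
  then show "g (k + 2 * m - 2 - n) = g (k + 2 * m - 2 - Suc n) - g (k + 2 * m - 2 - (n + m)) / \<rho>"
    "g (k + m - 1 - n) = g (k + m - 1 - Suc n) - g (k + m - 1 - (n + m)) / \<rho>"
    using g_rec[of "k + 2 * m - 2 - Suc n"] g_rec[of "k + m - 1 - Suc n"] assms two_le_m
    by simp_all
qed

lemma tight_prefix_rec:
  assumes "Suc n < k"
  shows "tight_prefix k n = tight_prefix k (Suc n) - tight_prefix k (n + m) / \<rho>"
  unfolding tight_prefix_def g_shift_rec[OF assms]
  by (simp add: algebra_simps diff_divide_distrib)

lemma tight_prefix_nonneg:
  assumes "1 \<le> k" "n < k + m - 1"
  shows "0 \<le> tight_prefix k n"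
proof (rule comparison_nonneg[OF _ _ _ assms(2)])
  show "0 \<le> tight_prefix k 0" using tight_prefix_0[OF assms(1)] by simp
qed (use tight_prefix_rec tight_prefix_tail in auto)

text \<open>Over \<open>m - 1\<close> steps \<open>g\<close> shrinks at most by the factor
  \<open>z ^ (m - 1) \<le> \<rho>\<close>. The lower bound yields monotonicity at the last step; the
  upper one keeps \<open>2 - last_ratio k\<close>, the time per unit of total, positive.\<close>

lemma last_ratio_bounds:
  assumes "1 \<le> k"
  shows "1 / \<rho> \<le> last_ratio k" "last_ratio k \<le> 1"
proof -
  have eq: "k + 2 * m - 2 = k + m - 1 + (m - 1)" using two_le_m by simp
  have pos: "0 < g (k + m - 1)" using assms by (intro g_pos) simp
  have "z ^ (m - 1) * 1 \<le> z ^ (m - 1) * real m"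
    using two_le_m z_gt_1 by (intro mult_left_mono) auto
  then have "z ^ (m - 1) \<le> \<rho>" using z_power_le by (simp add: mult.commute)
  moreover have "0 \<le> g (k + m - 1 + (m - 1))" by (rule g_nonneg)
  ultimately have "z ^ (m - 1) * g (k + m - 1 + (m - 1)) \<le> \<rho> * g (k + m - 1 + (m - 1))"
    by (intro mult_right_mono)
  then have "g (k + m - 1) \<le> \<rho> * g (k + m - 1 + (m - 1))"
    using g_le_add[of "k + m - 1" "m - 1"] assms by linarith
  then show "1 / \<rho> \<le> last_ratio k"
    unfolding last_ratio_def eq using pos rho_ge_4 by (simp add: field_simps)
  show "last_ratio k \<le> 1"
    unfolding last_ratio_def eq using pos g_add_le[of "k + m - 1" "m - 1"] assms
    by (simp add: divide_le_eq)
qed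

lemma last_ratio_nonneg: "0 \<le> last_ratio k"
  by (simp add: last_ratio_def g_nonneg)

text \<open>The numerator, read backwards from \<open>k'\<close>, also solves the recurrence, so
  \<open>comparison\<close> makes its quotient grow from \<open>last_ratio k'\<close> at 0 to
  \<open>last_ratio k\<close> at \<open>k' - k\<close>.\<close>

lemma last_ratio_antimono:
  assumes "1 \<le> k" "k \<le> k'"
  shows "last_ratio k' \<le> last_ratio k"
proof -
  let ?D = "\<lambda>n. g (k' + 2 * m - 2 - n)"
  have "?D 0 / g (k' + m - 1 - 0) \<le> ?D (k' - k) / g (k' + m - 1 - (k' - k))"
    using assms by (intro comparison) (use g_shift_rec(1)[of _ k'] g_nonneg in \<open>auto intro: eq_refl\<close>)
  moreover have "k' + 2 * m - 2 - (k' - k) = k + 2 * m - 2" "k' + m - 1 - (k' - k) = k + m - 1"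
    using assms two_le_m by auto
  ultimately show ?thesis by (simp add: last_ratio_def)
qed

lemma tight_eq:
  assumes "1 \<le> j" "j < k"
  shows "\<rho> * tight k W j = W * tight_prefix k (j + m - 1)"
proof -
  have "k + 2 * m - 2 - (j + m - 1) = k + m - 1 - j" "k + m - 1 - (j + m - 1) = k - j"
    using assms two_le_m by auto
  moreover have "\<rho> * tight k W j = W * g (k + m - 1 - j) - W * last_ratio k * g (k - j)"
    using assms rho_ge_4 by (simp add: tight_def)
  ultimately show ?thesis by (simp add: tight_prefix_def right_diff_distrib)
qed

lemma sum_tight:
  assumes "n < k"
  shows "(\<Sum>i = 1..n. tight k W i) = W * tight_prefix k n"
  using assms
proof (induction n)
  case 0
  then show ?case by (simp add: tight_prefix_0)
next
  case (Suc n)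
  have "\<rho> * tight k W (Suc n) = W * tight_prefix k (n + m)"
    using tight_eq[of "Suc n" k W] Suc.prems by simp
  moreover have "tight_prefix k n = tight_prefix k (Suc n) - tight_prefix k (n + m) / \<rho>"
    using Suc.prems by (rule tight_prefix_rec)
  ultimately have "tight k W (Suc n) = W * (tight_prefix k (Suc n) - tight_prefix k n)"
    using rho_ge_4 by (simp add: nonzero_eq_divide_eq mult.commute)
  then show ?case using Suc by (simp add: right_diff_distrib)
qed

lemma tight_prefix_pred:
  assumes "1 \<le> k"
  shows "tight_prefix k (k - 1) = 1 - last_ratio k"
proof -
  have "k + 2 * m - 2 - (k - 1) = 2 * m - 1" "k + m - 1 - (k - 1) = m" using assms two_le_m by auto
  then show ?thesis using g_plateau[of "2 * m - 1"] g_m two_le_m by (simp add: tight_prefix_def)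
qed

lemma sum_tight_total:
  assumes "1 \<le> k"
  shows "(\<Sum>i = 1..k. tight k W i) = W"
proof -
  have "(\<Sum>i = 1..k. tight k W i) = (\<Sum>i = 1..k - 1. tight k W i) + tight k W k"
    using assms sum.cl_ivl_Suc[of "tight k W" 1 "k - 1"] by simp
  also have "tight k W k = W * last_ratio k" by (simp add: tight_def)
  finally show ?thesis
    using assms sum_tight[of "k - 1" k W] tight_prefix_pred[of k] by (simp add: right_diff_distrib)
qed

lemma tight_prefix_mono:
  assumes "1 \<le> k" "Suc n < k + m - 1"
  shows "tight_prefix k n \<le> tight_prefix k (Suc n)"
proof (cases "Suc n < k")
  case True
  then have "0 \<le> tight_prefix k (n + m) / \<rho>"
    using tight_prefix_nonneg[of k "n + m"] rho_ge_4 assms by simp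
  then show ?thesis using tight_prefix_rec[OF True] by simp
next
  case False
  then consider "Suc n = k" | "k \<le> n" by linarith
  then show ?thesis
  proof cases
    case 1
    then show ?thesis
      using tight_prefix_pred[OF assms(1)] tight_prefix_tail[of k "Suc n"] assms
        last_ratio_nonneg[of k] by auto
  qed (use assms tight_prefix_tail[of k n] tight_prefix_tail[of k "Suc n"] in auto)
qed

text \<open>Competitiveness beyond the start and extendability hold with equality. Steps before the
  last are prefix sums divided by \<rho>, so they inherit monotonicity. Only the start and the
  budget limit \<open>W\<close>.\<close>

lemma feasible_tight:
  assumes k: "m \<le> k" and W: "0 \<le> W"
    and start: "W * tight_prefix k (m - 1) \<le> \<rho>"
    and budget: "W * (2 - last_ratio k) \<le> T"
  shows "feasible m \<rho> T k (tight k W)"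
  unfolding feasible_def
proof (intro conjI ballI)
  have k1: "1 \<le> k" using k two_le_m by simp
  show "m \<le> k" by (rule k)
  show "(\<Sum>i = 1..m - 1. tight k W i) \<le> \<rho>"
    using sum_tight[of "m - 1" k W] k two_le_m start by simp
  show "(\<Sum>i = 1..j + m - 1. tight k W i) \<le> \<rho> * tight k W j" if "j \<in> {1..k - m}" for j
    using that sum_tight[of "j + m - 1" k W] tight_eq[of j k W] two_le_m by auto
  \<comment> \<open>From \<open>k - m + 1\<close> on, the index \<open>j + m - 1\<close> lies where
    the prefix sum is the total.\<close>
  have E: "\<rho> * tight k W j = W" if "k - m + 1 \<le> j" "j < k" for j
    using that tight_eq[of j k W] tight_prefix_tail[of k "j + m - 1"] two_le_m k by auto
  show "(\<Sum>i = 1..k. tight k W i) \<le> \<rho> * tight k W j" if "j \<in> {k - m + 1..k - 1}" for j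
    using that k two_le_m E[of j] sum_tight_total[OF k1] by auto
  show "tight k W i \<le> tight k W (i + 1)" if "i \<in> {1..k - 1}" for i
  proof (cases "i + 1 = k")
    case True
    then have "\<rho> * tight k W i = W" using that two_le_m k by (intro E) auto
    then have "tight k W i = W * (1 / \<rho>)" using rho_ge_4 by (simp add: field_simps)
    also have "\<dots> \<le> W * last_ratio k"
      using last_ratio_bounds[OF k1] W by (intro mult_left_mono) auto
    finally show ?thesis using True by (simp add: tight_def)
  next
    case False
    then have i: "1 \<le> i" "i + 1 < k" using that by auto
    then have "tight_prefix k (i + m - 1) \<le> tight_prefix k (Suc (i + m - 1))"
      using k1 by (intro tight_prefix_mono) auto
    then have "W * tight_prefix k (i + m - 1) \<le> W * tight_prefix k (i + 1 + m - 1)"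
      using W i by (intro mult_left_mono) auto
    then have "\<rho> * tight k W i \<le> \<rho> * tight k W (i + 1)"
      using tight_eq[of i k W] tight_eq[of "i + 1" k W] i by simp
    then show ?thesis using rho_ge_4 by simp
  qed
  show "2 * (\<Sum>i = 1..k - 1. tight k W i) + tight k W k \<le> T"
  proof -
    have "tight k W k = W * last_ratio k" by (simp add: tight_def)
    then show ?thesis using budget sum_tight[of "k - 1" k W] k1 tight_prefix_pred[OF k1]
      by (simp add: right_diff_distrib)
  qed
qed

section \<open>Optimality for a fixed number of steps\<close>

text \<open>Clearance per unit of total: the last step and \<open>m - 1\<close> steps of size
  \<open>1 / \<rho>\<close> each.\<close>

definition rate :: "nat \<Rightarrow> real" where
  "rate k = last_ratio k + real (m - 1) / \<rho>"

lemma clearance_eq_diff: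
  assumes "m \<le> k"
  shows "clearance m k x = (\<Sum>i = 1..k. x i) - (\<Sum>i = 1..k - m. x i)"
proof -
  have "clearance m k x = (\<Sum>i = k - m + 1..k. x i)"
    unfolding clearance_def
    by (rule sum.reindex_bij_witness[of _ "\<lambda>i. k - i" "\<lambda>i. k - i"]) (use assms two_le_m in auto)
  moreover have "(\<Sum>i = 1..k. x i) = (\<Sum>i = 1..k - m. x i) + (\<Sum>i = k - m + 1..k. x i)"
    using assms sum.ub_add_nat[of 1 "k - m" x m] by simp
  ultimately show ?thesis by simp
qed

lemma clearance_tight:
  assumes "m \<le> k"
  shows "clearance m k (tight k W) = W * rate k"
proof -
  have k1: "1 \<le> k" using assms two_le_m by simp
  have up: "tight_prefix k (k - m + d) = tight_prefix k (k - m) + real d / \<rho>" if "d \<le> m - 1" for d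
    using that
  proof (induction d)
    case (Suc d)
    have "tight_prefix k (k - m + d) =
        tight_prefix k (Suc (k - m + d)) - tight_prefix k (k - m + d + m) / \<rho>"
      using Suc.prems assms by (intro tight_prefix_rec) auto
    moreover have "tight_prefix k (k - m + d + m) = 1"
      using Suc.prems assms by (intro tight_prefix_tail) auto
    ultimately show ?case using Suc by (simp add: add_divide_distrib)
  qed simp
  have "k - m + (m - 1) = k - 1" using assms two_le_m by simp
  then have "tight_prefix k (k - m) = 1 - rate k"
    using up[of "m - 1"] tight_prefix_pred[OF k1] by (simp add: rate_def)
  then show ?thesis
    using clearance_eq_diff[OF assms, of "tight k W"] sum_tight_total[OF k1, of W] assms two_le_m
      sum_tight[of "k - m" k W] by (simp add: right_diff_distrib)
qed

text \<open>The prefix sums of \<open>x\<close> minus those of the tight strategy of equal total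
  satisfy the recurrence as an inequality and vanish at 0 and from \<open>k\<close> on, so the
  maximum principle applies. Cutting at \<open>k\<close> by \<open>min\<close> merges the two kinds
  of constraints.\<close>

lemma tight_prefix_le_sum:
  assumes k: "m \<le> k"
    and x: "\<And>j. 1 \<le> j \<Longrightarrow> j < k \<Longrightarrow> (\<Sum>i = 1..min (j + m - 1) k. x i) \<le> \<rho> * x j"
    and n: "n < k"
  shows "(\<Sum>i = 1..k. x i) * tight_prefix k n \<le> (\<Sum>i = 1..n. x i)"
proof -
  define S where "S n = (\<Sum>i = 1..min n k. x i)" for n
  have "0 \<le> S n - S k * tight_prefix k n"
  proof (rule comparison_nonneg)
    fix n assume n: "Suc n < k"
    have "S (n + m) \<le> \<rho> * x (Suc n)" using x[of "Suc n"] n by (simp add: S_def)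
    then have "S (n + m) / \<rho> \<le> x (Suc n)" using rho_ge_4 by (simp add: field_simps)
    moreover have "S (Suc n) = S n + x (Suc n)" using n by (simp add: S_def)
    ultimately have "S n \<le> S (Suc n) - S (n + m) / \<rho>" by simp
    then show "S n - S k * tight_prefix k n
        \<le> S (Suc n) - S k * tight_prefix k (Suc n) - (S (n + m) - S k * tight_prefix k (n + m)) / \<rho>"
      using tight_prefix_rec[OF n] by (simp add: right_diff_distrib diff_divide_distrib)
  next
    show "0 \<le> S 0 - S k * tight_prefix k 0"
      using k two_le_m by (simp add: S_def tight_prefix_0)
  qed (use n two_le_m in \<open>auto simp: S_def tight_prefix_tail\<close>)
  then show ?thesis using n by (simp add: S_def)
qed

text \<open>The start is the prefix sum at \<open>m - 1\<close>, the time is \<open>W\<close> plus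
  that at \<open>k - 1\<close>, the clearance \<open>W\<close> minus that at \<open>k - m\<close>.
  Lower bounds on prefix sums therefore settle all three.\<close>

lemma feasible_bounds:
  assumes "feasible m \<rho> T k x"
  defines "W \<equiv> \<Sum>i = 1..k. x i"
  shows "W * tight_prefix k (m - 1) \<le> \<rho>" "W * (2 - last_ratio k) \<le> T"
    "clearance m k x \<le> W * rate k"
proof -
  have k: "m \<le> k" and start: "(\<Sum>i = 1..m - 1. x i) \<le> \<rho>"
    and C: "\<And>j. 1 \<le> j \<Longrightarrow> j \<le> k - m \<Longrightarrow> (\<Sum>i = 1..j + m - 1. x i) \<le> \<rho> * x j"
    and E: "\<And>j. k - m + 1 \<le> j \<Longrightarrow> j < k \<Longrightarrow> (\<Sum>i = 1..k. x i) \<le> \<rho> * x j"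
    and B: "2 * (\<Sum>i = 1..k - 1. x i) + x k \<le> T"
    using assms(1) by (auto simp: feasible_def)
  have k1: "1 \<le> k" using k two_le_m by simp
  have x: "(\<Sum>i = 1..min (j + m - 1) k. x i) \<le> \<rho> * x j" if "1 \<le> j" "j < k" for j
    using that k C[of j] E[of j] by (cases "j \<le> k - m") (simp_all add: min_absorb1 min_absorb2)
  note le = tight_prefix_le_sum[of k x, OF k x, folded W_def]
  show "W * tight_prefix k (m - 1) \<le> \<rho>" using le[of "m - 1"] start k two_le_m by linarith
  have "W = (\<Sum>i = 1..k - 1. x i) + x k"
    using k1 sum.cl_ivl_Suc[of x 1 "k - 1"] by (simp add: W_def)
  then show "W * (2 - last_ratio k) \<le> T"
    using le[of "k - 1"] B k1 unfolding tight_prefix_pred[OF k1] right_diff_distrib by linarith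
  have "W * tight_prefix k (k - m) \<le> (\<Sum>i = 1..k - m. x i)" using le[of "k - m"] k1 two_le_m by simp
  moreover have "W * rate k = W - W * tight_prefix k (k - m)"
    using clearance_tight[OF k, of W] clearance_eq_diff[OF k, of "tight k W"]
      sum_tight_total[OF k1, of W] sum_tight[of "k - m" k W] k1 two_le_m by simp
  ultimately show "clearance m k x \<le> W * rate k"
    using clearance_eq_diff[OF k, of x] by (simp add: W_def)
qed

lemma rate_nonneg: "0 \<le> rate k"
  using last_ratio_nonneg rho_ge_4 by (simp add: rate_def)

text \<open>The smaller of the two limits on the total, compared by cross-multiplication. In the
  second branch the budget binds.\<close>

definition best_total :: "real \<Rightarrow> nat \<Rightarrow> real" where
  "best_total T k =
     (if \<rho> * (2 - last_ratio k) < tight_prefix k (m - 1) * T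
      then \<rho> / tight_prefix k (m - 1) else T / (2 - last_ratio k))"

lemma best_total:
  assumes k: "m \<le> k" and T: "0 \<le> T"
  defines "W \<equiv> best_total T k"
  shows "0 \<le> W" "feasible m \<rho> T k (tight k W)"
    "feasible m \<rho> T k y \<Longrightarrow> clearance m k y \<le> W * rate k"
proof -
  let ?c = "tight_prefix k (m - 1)" and ?b = "2 - last_ratio k"
  have k1: "1 \<le> k" using k two_le_m by simp
  have b: "0 < ?b" using last_ratio_bounds[OF k1] by simp
  have c: "0 \<le> ?c" using k1 two_le_m by (intro tight_prefix_nonneg) auto
  \<comment> \<open>The left side is positive, so the strict inequality rules out a zero
    divisor.\<close>
  have cpos: "0 < ?c" if "\<rho> * ?b < ?c * T"
    using c that mult_pos_pos[of \<rho> ?b] b rho_ge_4 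
    by (metis less_le mult_zero_left less_asym less_le_trans zero_less_numeral)
  show W0: "0 \<le> W" using b c T rho_ge_4 by (simp add: W_def best_total_def)
  show "feasible m \<rho> T k (tight k W)"
    using cpos b by (intro feasible_tight k W0) (auto simp: W_def best_total_def field_simps)
  assume y: "feasible m \<rho> T k y"
  have "(\<Sum>i = 1..k. y i) \<le> W"
    using feasible_bounds(1,2)[OF y] cpos b by (auto simp: W_def best_total_def field_simps)
  then have "(\<Sum>i = 1..k. y i) * rate k \<le> W * rate k"
    using rate_nonneg by (rule mult_right_mono)
  then show "clearance m k y \<le> W * rate k" using feasible_bounds(3)[OF y] by simp
qed

section \<open>How many steps need to be tried\<close>

text \<open>As \<open>k\<close> grows, \<open>last_ratio\<close> does not increase, so a unit of
  total costs no less time and clears no more. Once the budget binds, the search may stop.\<close>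

lemma budget_limited_dominates:
  assumes k: "m \<le> k" "k \<le> k'" and T: "0 \<le> T"
    and limited: "\<not> \<rho> * (2 - last_ratio k) < tight_prefix k (m - 1) * T"
    and y: "feasible m \<rho> T k' y"
  shows "clearance m k' y \<le> best_total T k * rate k"
proof -
  have k1: "1 \<le> k" "1 \<le> k'" using k two_le_m by auto
  have r: "last_ratio k' \<le> last_ratio k" using k1 k by (intro last_ratio_antimono)
  have b: "0 < 2 - last_ratio k" "0 < 2 - last_ratio k'"
    using last_ratio_bounds[OF k1(1)] last_ratio_bounds[OF k1(2)] by auto
  have "(\<Sum>i = 1..k'. y i) \<le> T / (2 - last_ratio k')"
    using feasible_bounds(2)[OF y] b by (simp add: field_simps)
  also have "\<dots> \<le> T / (2 - last_ratio k)"
    using T b r by (intro divide_left_mono) auto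
  also have "\<dots> = best_total T k" using limited by (simp add: best_total_def)
  finally have "(\<Sum>i = 1..k'. y i) * rate k' \<le> best_total T k * rate k"
    using rate_nonneg r best_total(1)[OF k(1) T] by (intro mult_mono) (auto simp: rate_def)
  then show ?thesis using feasible_bounds(3)[OF y] by simp
qed

definition horizon :: "real \<Rightarrow> nat" where
  "horizon T = m * nat \<lceil>log 2 (max T 2)\<rceil>"

lemma horizon_ge: "m \<le> horizon T"
proof -
  have "1 \<le> log 2 (max T 2)" using log_le_cancel_iff[of 2 2 "max T 2"] by simp
  then have "1 \<le> nat \<lceil>log 2 (max T 2)\<rceil>" by linarith
  then show ?thesis by (simp add: horizon_def)
qed

text \<open>The powers of \<open>z\<close> satisfy the constraints of
  \<open>tight_prefix_le_sum\<close>, which bounds \<open>tight_prefix k (m - 1)\<close> by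
  \<open>(z ^ (m - 1) - 1) / (z ^ k - 1)\<close>. At the horizon \<open>z ^ k\<close> has reached
  \<open>T\<close>.\<close>

lemma budget_limited_at_horizon:
  assumes k: "horizon T \<le> k" and T: "0 \<le> T"
  shows "tight_prefix k (m - 1) * T \<le> \<rho> * (2 - last_ratio k)"
proof -
  let ?c = "tight_prefix k (m - 1)" and ?M = "max T 2"
  define l where "l = nat \<lceil>log 2 ?M\<rceil>"
  have mk: "m \<le> k" and k1: "1 \<le> k" using k horizon_ge[of T] two_le_m by auto
  have geo: "(z - 1) * (\<Sum>i = 1..n. z ^ i) = z * (z ^ n - 1)" for n
    by (induction n) (simp_all add: algebra_simps)
  have "(\<Sum>i = 1..k. z ^ i) * ?c \<le> (\<Sum>i = 1..m - 1. z ^ i)"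
  proof (rule tight_prefix_le_sum[OF mk])
    fix j assume j: "1 \<le> j" "j < k"
    have "(z - 1) * (\<Sum>i = 1..min (j + m - 1) k. z ^ i) \<le> (z - 1) * (\<Sum>i = 1..j + m - 1. z ^ i)"
      using z_gt_1 by (intro mult_left_mono sum_mono2) auto
    also have "\<dots> \<le> z * z ^ (j + m - 1)"
      unfolding geo using z_gt_1 by simp
    also have "\<dots> = (z - 1) * ((real m * z ^ (m - 1)) * z ^ j)"
      using z_diff j two_le_m by (simp add: mult.assoc[symmetric] power_add[symmetric] add.commute)
    also have "\<dots> \<le> (z - 1) * (\<rho> * z ^ j)"
      using z_gt_1 z_power_le by (intro mult_left_mono mult_right_mono) auto
    finally show "(\<Sum>i = 1..min (j + m - 1) k. z ^ i) \<le> \<rho> * z ^ j"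
      using z_gt_1 by simp
  qed (use mk two_le_m in auto)
  then have "(z - 1) * ((\<Sum>i = 1..k. z ^ i) * ?c) \<le> (z - 1) * (\<Sum>i = 1..m - 1. z ^ i)"
    using z_gt_1 by (intro mult_left_mono) auto
  then have "z * ((z ^ k - 1) * ?c) \<le> z * (z ^ (m - 1) - 1)"
    by (simp only: geo mult.assoc[symmetric])
  then have c: "(z ^ k - 1) * ?c \<le> z ^ (m - 1) - 1" using z_gt_1 by simp
  have "?M = 2 powr (log 2 ?M)" by simp
  also have "\<dots> \<le> 2 powr real l" unfolding l_def by (intro powr_mono) linarith+
  also have "\<dots> = 2 ^ l" by (simp add: powr_realpow)
  also have "\<dots> \<le> (z ^ (m - 1)) ^ l" using two_le_z_power by (intro power_mono) auto
  also have "\<dots> = z ^ ((m - 1) * l)" by (simp add: power_mult)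
  also have "\<dots> \<le> z ^ k"
  proof (rule power_increasing)
    have "(m - 1) * l \<le> m * l" by simp
    also have "\<dots> \<le> k" using k by (simp add: horizon_def l_def)
    finally show "(m - 1) * l \<le> k" .
  qed (use z_gt_1 in simp)
  finally have M: "?M \<le> z ^ k" .
  have c0: "0 \<le> ?c" using k1 two_le_m by (intro tight_prefix_nonneg) auto
  \<comment> \<open>From \<open>z ^ k \<ge> 2\<close> follows
    \<open>z ^ k \<le> 2 * (z ^ k - 1)\<close>; below, \<open>m \<ge> 2\<close> absorbs the factor
    2.\<close>
  have "T \<le> 2 * (z ^ k - 1)" using M by simp
  then have "T * ?c \<le> 2 * (z ^ k - 1) * ?c" using c0 by (rule mult_right_mono)
  also have "\<dots> \<le> 2 * z ^ (m - 1)" using c unfolding mult.assoc by linarith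
  also have "\<dots> \<le> real m * z ^ (m - 1)" using two_le_m z_gt_1 by (intro mult_right_mono) auto
  also have "\<dots> \<le> \<rho> * 1" using z_power_le by simp
  also have "\<dots> \<le> \<rho> * (2 - last_ratio k)"
    using last_ratio_bounds[OF k1] rho_ge_4 by (intro mult_left_mono) auto
  finally show ?thesis by (simp add: mult.commute)
qed

end


section \<open>Reasoning about programs\<close>

definition runs :: "com \<Rightarrow> memory \<Rightarrow> nat \<Rightarrow> (memory \<Rightarrow> bool) \<Rightarrow> bool" where
  "runs c s b Q \<longleftrightarrow> (\<exists>t s'. exec c s t s' \<and> t \<le> b \<and> Q s')"

lemma runs_weaken:
  "runs c s b P \<Longrightarrow> b \<le> b' \<Longrightarrow> (\<And>s'. P s' \<Longrightarrow> Q s') \<Longrightarrow> runs c s b' Q"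
  unfolding runs_def by (meson le_trans)

lemma runs_Seq:
  "runs c s b P \<Longrightarrow> (\<And>s'. P s' \<Longrightarrow> runs d s' b' Q) \<Longrightarrow> runs (Seq c d) s (b + b') Q"
  unfolding runs_def by (meson exec.Seq add_mono)

text \<open>The measure bounds the number of passes and may drop by more than one, hence strong
  induction. The failing test at the end costs one more guard.\<close>

lemma runs_While:
  assumes "I s" and "\<mu> s \<le> n"
    and step: "\<And>s. I s \<Longrightarrow> bval e s \<Longrightarrow> runs c s b (\<lambda>s'. I s' \<and> \<mu> s' < (\<mu> s :: nat))"
  shows "runs (While e c) s (n * (bcost e + b) + bcost e) (\<lambda>s'. I s' \<and> \<not> bval e s')"
  using \<open>I s\<close> \<open>\<mu> s \<le> n\<close>
proof (induction n arbitrary: s rule: less_induct)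
  case (less n)
  show ?case
  proof (cases "bval e s")
    case True
    obtain t s' where s': "exec c s t s'" "t \<le> b" "I s'" "\<mu> s' < \<mu> s"
      using step[OF less.prems(1) True] by (auto simp: runs_def)
    obtain u s'' where s'': "exec (While e c) s' u s''" "u \<le> \<mu> s' * (bcost e + b) + bcost e"
      "I s''" "\<not> bval e s''"
      using less.IH[of "\<mu> s'" s'] s'(3,4) less.prems(2) by (auto simp: runs_def)
    have "Suc (\<mu> s') * (bcost e + b) \<le> n * (bcost e + b)"
      using s'(4) less.prems(2) by (intro mult_le_mono1) simp
    then have "bcost e + t + u \<le> n * (bcost e + b) + bcost e"
      using s'(2) s''(2) by simp
    then show ?thesis
      using exec.WhileTrue[OF True s'(1) s''(1)] s'' unfolding runs_def by blast
  next
    case False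
    then show ?thesis
      using exec.WhileFalse[OF False] less.prems unfolding runs_def by fastforce
  qed
qed

section \<open>Effect and cost of loop-free code\<close>

primrec loop_free :: "com \<Rightarrow> bool" where
  "loop_free Skip \<longleftrightarrow> True"
| "loop_free (NSet a i e) \<longleftrightarrow> True"
| "loop_free (RSet a i e) \<longleftrightarrow> True"
| "loop_free (Seq c d) \<longleftrightarrow> loop_free c \<and> loop_free d"
| "loop_free (If b c d) \<longleftrightarrow> loop_free c \<and> loop_free d"
| "loop_free (While b c) \<longleftrightarrow> False"

primrec effect :: "com \<Rightarrow> memory \<Rightarrow> memory" where
  "effect Skip s = s"
| "effect (NSet a i e) s = nset a (nval i s) (nval e s) s"
| "effect (RSet a i e) s = rset a (nval i s) (rval e s) s"
| "effect (Seq c d) s = effect d (effect c s)"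
| "effect (If b c d) s = (if bval b s then effect c s else effect d s)"
| "effect (While b c) s = s"

text \<open>Charging both branches of a conditional makes the bound independent of the
  state.\<close>

primrec max_cost :: "com \<Rightarrow> nat" where
  "max_cost Skip = 1"
| "max_cost (NSet a i e) = ncost i + ncost e + 1"
| "max_cost (RSet a i e) = ncost i + rcost e + 1"
| "max_cost (Seq c d) = max_cost c + max_cost d"
| "max_cost (If b c d) = bcost b + max_cost c + max_cost d"
| "max_cost (While b c) = 0"

lemma exec_loop_free: "loop_free c \<Longrightarrow> \<exists>t \<le> max_cost c. exec c s t (effect c s)"
proof (induction c arbitrary: s)
  case (Seq c d)
  then obtain t u where "t \<le> max_cost c" "exec c s t (effect c s)"
    "u \<le> max_cost d" "exec d (effect c s) u (effect d (effect c s))"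
    by (metis loop_free.simps(4))
  then show ?case by (intro exI[of _ "t + u"]) (auto intro: exec.Seq)
next
  case (If b c d)
  then obtain t u where *: "t \<le> max_cost c" "exec c s t (effect c s)"
    "u \<le> max_cost d" "exec d s u (effect d s)"
    by (metis loop_free.simps(5))
  show ?case
  proof (cases "bval b s")
    case True
    then show ?thesis using * by (intro exI[of _ "bcost b + t"]) (auto intro: exec.IfTrue)
  next
    case False
    then show ?thesis using * by (intro exI[of _ "bcost b + u"]) (auto intro: exec.IfFalse)
  qed
next
  case Skip
  then show ?case using exec.Skip[of s] by auto
next
  case (NSet a i e)
  then show ?case using exec.NSet[of a i e s] by auto
next
  case (RSet a i e)
  then show ?case using exec.RSet[of a i e s] by auto
qed simp

lemma runs_loop_free: "loop_free c \<Longrightarrow> Q (effect c s) \<Longrightarrow> runs c s (max_cost c) Q"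
  using exec_loop_free[of c s] unfolding runs_def by blast

lemma nats_nset [simp]: "nats (nset a i v s) = (nats s)(a := (nats s a)(i := v))"
  by (simp add: nset_def)

lemma reals_nset [simp]: "reals (nset a i v s) = reals s"
  by (simp add: nset_def)

lemma nats_rset [simp]: "nats (rset a i v s) = nats s"
  by (simp add: rset_def)

lemma reals_rset [simp]: "reals (rset a i v s) = (reals s)(a := (reals s a)(i := v))"
  by (simp add: rset_def)


section \<open>The program\<close>

abbreviation seq :: "com \<Rightarrow> com \<Rightarrow> com" (infixr ";;" 60) where "c ;; d \<equiv> Seq c d"

abbreviation nreg :: "nat \<Rightarrow> nexp" where "nreg a \<equiv> NGet a (NConst 0)"
abbreviation rreg :: "nat \<Rightarrow> rexp" where "rreg a \<equiv> RGet a (NConst 0)"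
abbreviation set_nreg :: "nat \<Rightarrow> nexp \<Rightarrow> com" where "set_nreg a \<equiv> NSet a (NConst 0)"
abbreviation set_rreg :: "nat \<Rightarrow> rexp \<Rightarrow> com" where "set_rreg a \<equiv> RSet a (NConst 0)"

text \<open>
  Natural registers: 0 holds \<open>m\<close> (finally the output \<open>k\<close>), 1 the next index to be filled or written, 2 the current \<open>k\<close>,
  3 the stop flag, 4 the best \<open>k\<close>. Real array 1 is the table of the impulse response. Real
  registers: 2 and 3 hold the initial segment and the last ratio of the tight strategy of
  total 1, 4 its best scaling, 5 the best clearance with total in 6 and last step in 7, and
  8 the current clearance.
\<close>

definition extend :: com where
  "extend =
     RSet 1 (nreg 1)
       (RSub (RGet 1 (NSub (nreg 1) (NConst 1)))
             (RDiv (RGet 1 (NSub (nreg 1) (nreg 0))) (rreg 0))) ;;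
     set_nreg 1 (NAdd (nreg 1) (NConst 1))"

text \<open>For the prefix sum at \<open>m - 1\<close>, the two table indices in
  \<open>tight_prefix\<close> become \<open>k + m - 1\<close> and \<open>k\<close>.\<close>

definition evaluate :: com where
  "evaluate =
     set_rreg 3 (RDiv (RGet 1 (NSub (NAdd (nreg 2) (NAdd (nreg 0) (nreg 0))) (NConst 2)))
                      (RGet 1 (NSub (NAdd (nreg 2) (nreg 0)) (NConst 1)))) ;;
     set_rreg 2 (RSub (RGet 1 (NSub (NAdd (nreg 2) (nreg 0)) (NConst 1)))
                      (RMul (rreg 3) (RGet 1 (nreg 2))))"

text \<open>The case distinction of \<open>best_total\<close>; the branch where the budget binds
  also raises the stop flag.\<close>

definition rescale :: com where
  "rescale =
     If (RLess (RMul (rreg 0) (RSub (ROf (NConst 2)) (rreg 3)))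
               (RMul (rreg 2) (RGet 0 (NConst 1))))
       (set_rreg 4 (RDiv (rreg 0) (rreg 2)))
       (set_rreg 4 (RDiv (RGet 0 (NConst 1)) (RSub (ROf (NConst 2)) (rreg 3))) ;;
        set_nreg 3 (NConst 1)) ;;
     set_rreg 8 (RMul (rreg 4)
       (RAdd (rreg 3) (RDiv (ROf (NSub (nreg 0) (NConst 1))) (rreg 0))))"

definition record_best :: com where
  "record_best =
     If (RLess (rreg 5) (rreg 8))
       (set_rreg 5 (rreg 8) ;; set_rreg 6 (rreg 4) ;; set_rreg 7 (RMul (rreg 4) (rreg 3)) ;;
        set_nreg 4 (nreg 2))
       Skip ;;
     set_nreg 2 (NAdd (nreg 2) (NConst 1))"

abbreviation examine :: com where "examine \<equiv> evaluate ;; rescale ;; record_best"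

text \<open>The case \<open>j < k\<close> of \<open>tight\<close>, with
  \<open>W * last_ratio k\<close> taken from register 7. Output overwrites the budget in cell 1;
  from here on only \<rho> in cell 0 is read as input.\<close>

definition emit :: com where
  "emit =
     RSet 0 (nreg 1)
       (RDiv (RSub (RMul (rreg 6) (RGet 1 (NSub (NSub (NAdd (nreg 4) (nreg 0)) (NConst 1)) (nreg 1))))
                   (RMul (rreg 7) (RGet 1 (NSub (nreg 4) (nreg 1)))))
             (rreg 0)) ;;
     set_nreg 1 (NAdd (nreg 1) (NConst 1))"

definition initialise :: com where
  "initialise =
     RSet 1 (nreg 0) (ROf (NConst 1)) ;; set_nreg 1 (NAdd (nreg 0) (NConst 1)) ;;
     set_nreg 2 (nreg 0) ;; set_nreg 4 (nreg 0)"

definition finish :: com where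
  "finish = RSet 0 (nreg 4) (rreg 7) ;; set_nreg 0 (nreg 4)"

text \<open>Filling all cells below \<open>3 * m - 2\<close> leaves exactly one new cell,
  \<open>k + 2 * m - 2\<close>, to compute for each \<open>k\<close> from \<open>m\<close>
  on.\<close>

definition fill_guard :: bexp where
  "fill_guard = NLess (nreg 1) (NSub (NAdd (nreg 0) (NAdd (nreg 0) (nreg 0))) (NConst 2))"

definition scan_guard :: bexp where
  "scan_guard = NLess (nreg 3) (NConst 1)"

definition emit_guard :: bexp where
  "emit_guard = NLess (nreg 1) (nreg 4)"

definition clear_star :: com where
  "clear_star =
     initialise ;;
     While fill_guard extend ;;
     While scan_guard (extend ;; examine) ;;
     set_nreg 1 (NConst 1) ;;
     While emit_guard emit ;;
     finish"

section \<open>Loop invariants and correctness of the program\<close>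

context star
begin

definition filled :: "real \<Rightarrow> memory \<Rightarrow> bool" where
  "filled T s \<longleftrightarrow> nats s 0 0 = m \<and> reals s 0 0 = \<rho> \<and> reals s 0 (Suc 0) = T \<and>
     m < nats s 1 0 \<and> (\<forall>n < nats s 1 0. reals s 1 n = g n)"

lemma filled_extend:
  assumes "filled T s"
  shows "filled T (effect extend s)"
proof -
  let ?i = "nats s 1 0"
  have i: "m < ?i" using assms by (simp add: filled_def)
  then have "g ?i = g (?i - 1) - g (?i - m) / \<rho>" using g_rec[of "?i - 1"] by simp
  then show ?thesis using assms i two_le_m by (auto simp: filled_def extend_def less_Suc_eq)
qed

text \<open>Only the scaling of the best strategy is stored, so an update takes constant time; its
  steps are rebuilt from the table at the end.\<close>

definition incumbent :: "real \<Rightarrow> memory \<Rightarrow> bool" where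
  "incumbent T s \<longleftrightarrow>
     (let k = nats s 4 0; W = reals s 6 0 in
        reals s 7 0 = W * last_ratio k \<and> reals s 5 0 = W * rate k \<and>
        feasible m \<rho> T k (tight k W))"

text \<open>The stop flag changes the claim: while it is 0, the incumbent beats all strategies with
  fewer than \<open>k\<close> steps; once raised, those of every length.\<close>

definition scan_inv :: "real \<Rightarrow> memory \<Rightarrow> bool" where
  "scan_inv T s \<longleftrightarrow> (let k = nats s 2 0 in
     filled T s \<and> incumbent T s \<and> nats s 1 0 = k + 2 * m - 2 \<and> m \<le> k \<and> nats s 4 0 \<le> k \<and>
     nats s 4 0 \<le> horizon T \<and>
     (nats s 3 0 = 0 \<longrightarrow> k \<le> horizon T) \<and>
     (\<forall>k' y. (nats s 3 0 = 0 \<longrightarrow> k' < k) \<longrightarrow> feasible m \<rho> T k' y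
        \<longrightarrow> clearance m k' y \<le> reals s 5 0))"

lemma scan_step:
  assumes T: "0 \<le> T" and inv: "scan_inv T s" and flag: "nats s 3 0 = 0"
  defines "s' \<equiv> effect (extend ;; examine) s"
  shows "scan_inv T s'" "nats s' 2 0 = Suc (nats s 2 0)"
proof -
  define u where "u = effect extend s"
  define k where "k = nats s 2 0"
  have s': "s' = effect examine u" by (simp add: s'_def u_def)
  have u: "filled T u" "nats u 2 0 = k" "nats u 3 0 = 0" "nats u 4 0 = nats s 4 0"
    "nats u 1 0 = k + 2 * m - 1"
    "reals u 5 0 = reals s 5 0" "reals u 6 0 = reals s 6 0" "reals u 7 0 = reals s 7 0"
    using inv flag filled_extend[of T s] two_le_m
    by (auto simp: scan_inv_def Let_def u_def k_def extend_def)
  have k: "m \<le> k" "k \<le> horizon T" using inv flag by (auto simp: scan_inv_def Let_def k_def)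
  let ?lim = "\<not> \<rho> * (2 - last_ratio k) < tight_prefix k (m - 1) * T"
  let ?W = "best_total T k"
  have g: "reals u 1 n = g n" if "n \<le> k + 2 * m - 2" for n
    using u(1,5) that k two_le_m by (auto simp: filled_def)
  have regs: "nats u 0 0 = m" "reals u 0 0 = \<rho>" "reals u 0 (Suc 0) = T"
    using u(1) by (auto simp: filled_def)
  have ratio: "reals u 1 (k + (m + m) - 2) / reals u 1 (k + m - Suc 0) = last_ratio k"
    using g[of "k + 2 * m - 2"] g[of "k + m - 1"] two_le_m
    by (simp add: last_ratio_def mult_2)
  have prefix: "reals u 1 (k + m - Suc 0) - last_ratio k * reals u 1 k = tight_prefix k (m - 1)"
  proof -
    have "k + 2 * m - 2 - (m - 1) = k + m - 1" "k + m - 1 - (m - 1) = k" using two_le_m by auto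
    then show ?thesis using g[of k] g[of "k + m - 1"] two_le_m by (simp add: tight_prefix_def)
  qed
  define v where "v = effect evaluate u"
  have v: "nats v = nats u" "reals v 0 = reals u 0" "reals v 1 = reals u 1"
    "reals v 2 0 = tight_prefix k (m - 1)" "reals v 3 0 = last_ratio k"
    "reals v 5 = reals u 5" "reals v 6 = reals u 6" "reals v 7 = reals u 7"
    using ratio prefix
    by (simp_all add: v_def evaluate_def u regs del: times_divide_eq_left)
  define w where "w = effect rescale v"
  have w: "nats w 0 = nats u 0" "nats w 1 = nats u 1" "nats w 2 = nats u 2"
    "nats w 3 0 = (if ?lim then 1 else 0)" "nats w 4 = nats u 4"
    "reals w 0 = reals u 0" "reals w 1 = reals u 1" "reals w 3 0 = last_ratio k"
    "reals w 4 0 = ?W" "reals w 8 0 = ?W * rate k"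
    "reals w 5 = reals u 5" "reals w 6 = reals u 6" "reals w 7 = reals u 7"
    using v(3) by (simp_all add: w_def rescale_def u v regs best_total_def rate_def)
  have res: "nats s' 0 0 = m" "reals s' 0 = reals u 0" "reals s' 1 = reals u 1"
    "nats s' 1 0 = nats u 1 0" "nats s' 2 0 = Suc k" "nats s' 3 0 = (if ?lim then 1 else 0)"
    "nats s' 4 0 = (if reals s 5 0 < ?W * rate k then k else nats s 4 0)"
    "reals s' 5 0 = max (reals s 5 0) (?W * rate k)"
    "reals s' 6 0 = (if reals s 5 0 < ?W * rate k then ?W else reals s 6 0)"
    "reals s' 7 0 = (if reals s 5 0 < ?W * rate k then ?W * last_ratio k else reals s 7 0)"
    using w(2,7)
    by (simp_all add: s' record_best_def v_def[symmetric] w_def[symmetric] w u regs)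
  show "nats s' 2 0 = Suc (nats s 2 0)" using res by (simp add: k_def)
  have "filled T s'" using u(1) res by (simp add: filled_def)
  moreover have "incumbent T s'"
    using inv best_total(2)[OF k(1) T] res by (auto simp: scan_inv_def incumbent_def Let_def)
  \<comment> \<open>At \<open>k = horizon T\<close> the budget binds, so the scan can only go on
    below the horizon.\<close>
  moreover have "Suc k \<le> horizon T" if "\<not> ?lim"
    using that budget_limited_at_horizon[of T k] T k by (cases "k = horizon T") auto
  moreover have "clearance m k' y \<le> reals s' 5 0"
    if less: "nats s' 3 0 = 0 \<longrightarrow> k' < Suc k" and y: "feasible m \<rho> T k' y" for k' y
  proof -
    have mk': "m \<le> k'" using y by (simp add: feasible_def)
    \<comment> \<open>Shorter strategies fall to the old invariant, equal length to
      \<open>best_total\<close>; longer ones matter only once the flag is raised, and then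
      \<open>budget_limited_dominates\<close> applies.\<close>
    consider "k' < k" | "k' = k" | "k < k'" by linarith
    then show ?thesis
    proof cases
      case 1
      then have "clearance m k' y \<le> reals s 5 0"
        using inv y by (auto simp: scan_inv_def Let_def k_def)
      then show ?thesis using res by simp
    next
      case 2
      then show ?thesis using best_total(3)[OF k(1) T] y res by (simp add: le_max_iff_disj)
    next
      case 3
      then have ?lim using less res by (auto split: if_splits)
      then have "clearance m k' y \<le> ?W * rate k"
        using 3 by (intro budget_limited_dominates[OF k(1) _ T _ y]) auto
      then show ?thesis using res by simp
    qed
  qed
  ultimately show "scan_inv T s'"
    using inv res u k two_le_m by (auto simp: scan_inv_def Let_def k_def)
qed

definition emit_inv :: "nat \<Rightarrow> real \<Rightarrow> memory \<Rightarrow> bool" where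
  "emit_inv k W s \<longleftrightarrow>
     nats s 0 0 = m \<and> reals s 0 0 = \<rho> \<and> nats s 4 0 = k \<and> 1 \<le> nats s 1 0 \<and>
     reals s 6 0 = W \<and> reals s 7 0 = W * last_ratio k \<and>
     (\<forall>n < k + m - 1. reals s 1 n = g n) \<and>
     (\<forall>j. 1 \<le> j \<longrightarrow> j < nats s 1 0 \<longrightarrow> j < k \<longrightarrow> reals s 0 j = tight k W j)"

lemma emit_step:
  assumes "emit_inv k W s" "nats s 1 0 < k"
  shows "emit_inv k W (effect emit s)"
  using assms two_le_m
  by (auto simp: emit_inv_def emit_def tight_def less_Suc_eq)

text \<open>The output array agrees with \<open>tight\<close> in cells 1 to \<open>k\<close> only;
  cell 0 still holds \<rho>.\<close>

lemma clearance_cong: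
  assumes "m \<le> k" "\<And>i. 1 \<le> i \<Longrightarrow> i \<le> k \<Longrightarrow> x i = y i"
  shows "clearance m k x = clearance m k y"
  unfolding clearance_def using assms two_le_m by (intro sum.cong) auto

lemma feasible_cong:
  assumes "\<And>i. 1 \<le> i \<Longrightarrow> i \<le> k \<Longrightarrow> x i = y i"
  shows "feasible m \<rho> T k x \<longleftrightarrow> feasible m \<rho> T k y"
proof (cases "m \<le> k")
  case True
  have sum: "sum x {1..n} = sum y {1..n}" if "n \<le> k" for n
    using that assms by (intro sum.cong) auto
  have C: "sum x {1..j + m - 1} = sum y {1..j + m - 1} \<and> x j = y j" if "j \<in> {1..k - m}" for j
    using that True assms by (intro conjI sum) auto
  have E: "x j = y j" if "j \<in> {k - m + 1..k - 1}" for j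
    using that by (intro assms) auto
  have M: "x i = y i \<and> x (i + 1) = y (i + 1)" if "i \<in> {1..k - 1}" for i
    using that by (intro conjI assms) auto
  have B: "x k = y k" using True two_le_m by (intro assms) auto
  have "m - 1 \<le> k" using True by simp
  then show ?thesis
    unfolding feasible_def
    by (simp only: sum[of "m - 1"] sum[of k] sum[of "k - 1"] C E M B order_refl diff_le_self
        cong: ball_cong)
qed (simp add: feasible_def)

lemma clear_star_runs:
  assumes T: "0 \<le> T"
  shows "runs clear_star (input m \<rho> T)
    (max_cost initialise +
     (2 * m * (bcost fill_guard + max_cost extend) + bcost fill_guard +
     (Suc (horizon T) * (bcost scan_guard + max_cost (extend ;; examine)) + bcost scan_guard +
     (max_cost (set_nreg 1 (NConst 1)) +
     (horizon T * (bcost emit_guard + max_cost emit) + bcost emit_guard +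
      max_cost finish)))))
    (\<lambda>s. optimal_strategy m \<rho> T (output_steps s) (output_strategy s))"
  unfolding clear_star_def
proof (rule runs_Seq)
  let ?fill = "\<lambda>s. filled T s \<and> nats s 1 0 \<le> 3 * m - 2 \<and> nats s 2 0 = m \<and> nats s 3 0 = 0 \<and>
    nats s 4 0 = m \<and> reals s 5 0 = 0 \<and> reals s 6 0 = 0 \<and> reals s 7 0 = 0"
  \<comment> \<open>The first incumbent is the zero strategy, encoded by the registers that start at
    0.\<close>
  have zero: "feasible m \<rho> T m (tight m 0)"
    using T rho_ge_4 by (intro feasible_tight) auto
  show "runs initialise (input m \<rho> T) (max_cost initialise) ?fill"
    by (rule runs_loop_free)
      (use two_le_m g_below g_m in \<open>auto simp: initialise_def filled_def input_def less_Suc_eq\<close>)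
  fix s assume fill: "?fill s"
  show "runs (While fill_guard extend ;; While scan_guard (extend ;; examine) ;;
        set_nreg 1 (NConst 1) ;; While emit_guard emit ;; finish) s
      (2 * m * (bcost fill_guard + max_cost extend) + bcost fill_guard +
       (Suc (horizon T) * (bcost scan_guard + max_cost (extend ;; examine)) + bcost scan_guard +
       (max_cost (set_nreg 1 (NConst 1)) +
       (horizon T * (bcost emit_guard + max_cost emit) + bcost emit_guard +
        max_cost finish))))
      (\<lambda>s. optimal_strategy m \<rho> T (output_steps s) (output_strategy s))"
  proof (rule runs_Seq)
    let ?\<mu> = "\<lambda>s. 3 * m - 2 - nats s 1 0"
    have "runs (While fill_guard extend) s
        (2 * m * (bcost fill_guard + max_cost extend) + bcost fill_guard)
        (\<lambda>s'. ?fill s' \<and> \<not> bval fill_guard s')"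
    proof (rule runs_While[of ?fill, OF fill])
      show "?\<mu> s \<le> 2 * m" using fill by (auto simp: filled_def)
    next
      fix s assume s: "?fill s" and "bval fill_guard s"
      then have "nats s 1 0 < 3 * m - 2" by (simp add: fill_guard_def filled_def)
      moreover from s have "filled T (effect extend s)" by (intro filled_extend) simp
      ultimately show "runs extend s (max_cost extend) (\<lambda>s'. ?fill s' \<and> ?\<mu> s' < ?\<mu> s)"
        using s by (intro runs_loop_free) (auto simp: extend_def)
    qed
    moreover have "scan_inv T s'" if "?fill s'" "\<not> bval fill_guard s'" for s'
      using that zero horizon_ge[of T] two_le_m
      by (auto simp: scan_inv_def incumbent_def fill_guard_def filled_def feasible_def)
    ultimately show "runs (While fill_guard extend) s
        (2 * m * (bcost fill_guard + max_cost extend) + bcost fill_guard)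
        (\<lambda>s'. scan_inv T s' \<and> nats s' 2 0 = m)"
      by (elim runs_weaken) auto
  next
    fix s assume s: "scan_inv T s \<and> nats s 2 0 = m"
    show "runs (While scan_guard (extend ;; examine) ;; set_nreg 1 (NConst 1) ;;
        While emit_guard emit ;; finish) s
      (Suc (horizon T) * (bcost scan_guard + max_cost (extend ;; examine)) + bcost scan_guard +
       (max_cost (set_nreg 1 (NConst 1)) +
       (horizon T * (bcost emit_guard + max_cost emit) + bcost emit_guard +
        max_cost finish)))
      (\<lambda>s. optimal_strategy m \<rho> T (output_steps s) (output_strategy s))"
    proof (rule runs_Seq)
      \<comment> \<open>With \<open>Suc\<close>, the measure is still positive at the horizon, so
        raising the flag there decreases it.\<close>
      let ?\<mu> = "\<lambda>s. if nats s 3 0 = 0 then Suc (horizon T) - nats s 2 0 else 0"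
      have "runs (While scan_guard (extend ;; examine)) s
          (Suc (horizon T) * (bcost scan_guard + max_cost (extend ;; examine)) + bcost scan_guard)
          (\<lambda>s'. scan_inv T s' \<and> \<not> bval scan_guard s')"
      proof (rule runs_While[where \<mu> = ?\<mu>])
        fix s assume s: "scan_inv T s" and "bval scan_guard s"
        then have flag: "nats s 3 0 = 0" by (simp add: scan_guard_def)
        then have "nats s 2 0 \<le> horizon T" using s by (simp add: scan_inv_def Let_def)
        then show "runs (extend ;; examine) s (max_cost (extend ;; examine))
            (\<lambda>s'. scan_inv T s' \<and> ?\<mu> s' < ?\<mu> s)"
          using scan_step[OF T s flag] flag
          by (intro runs_loop_free)
            (auto simp: extend_def evaluate_def rescale_def record_best_def simp del: effect.simps)
      qed (use s in simp_all)
      then show "runs (While scan_guard (extend ;; examine)) s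
          (Suc (horizon T) * (bcost scan_guard + max_cost (extend ;; examine)) + bcost scan_guard)
          (\<lambda>s'. scan_inv T s' \<and> nats s' 3 0 \<noteq> 0)"
        by (elim runs_weaken) (simp_all add: scan_guard_def)
    next
      fix s assume s: "scan_inv T s \<and> nats s 3 0 \<noteq> 0"
      define k where "k = nats s 4 0"
      define W where "W = reals s 6 0"
      have feas: "feasible m \<rho> T k (tight k W)"
        and best: "reals s 5 0 = W * rate k" "reals s 7 0 = W * last_ratio k"
        and opt: "feasible m \<rho> T k' y \<Longrightarrow> clearance m k' y \<le> reals s 5 0" for k' y
        using s by (auto simp: scan_inv_def incumbent_def Let_def k_def W_def)
      have k: "m \<le> k" "k \<le> horizon T" "k \<le> nats s 2 0"
        using feas s by (auto simp: feasible_def scan_inv_def Let_def k_def)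
      have start: "emit_inv k W (effect (set_nreg 1 (NConst 1)) s)"
        using s k best two_le_m
        by (auto simp: emit_inv_def scan_inv_def filled_def Let_def k_def W_def)
      show "runs (set_nreg 1 (NConst 1) ;; While emit_guard emit ;; finish) s
        (max_cost (set_nreg 1 (NConst 1)) +
         (horizon T * (bcost emit_guard + max_cost emit) + bcost emit_guard + max_cost finish))
        (\<lambda>s. optimal_strategy m \<rho> T (output_steps s) (output_strategy s))"
      proof (rule runs_Seq)
        show "runs (set_nreg 1 (NConst 1)) s (max_cost (set_nreg 1 (NConst 1)))
            (\<lambda>s'. emit_inv k W s')"
          by (rule runs_loop_free) (simp, rule start)
        fix s assume start: "emit_inv k W s"
        show "runs (While emit_guard emit ;; finish) s
          (horizon T * (bcost emit_guard + max_cost emit) + bcost emit_guard + max_cost finish)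
          (\<lambda>s. optimal_strategy m \<rho> T (output_steps s) (output_strategy s))"
        proof (rule runs_Seq)
          let ?\<mu> = "\<lambda>s. k - nats s 1 0"
          have "runs (While emit_guard emit) s
              (horizon T * (bcost emit_guard + max_cost emit) + bcost emit_guard)
              (\<lambda>s'. emit_inv k W s' \<and> \<not> bval emit_guard s')"
          proof (rule runs_While[of "emit_inv k W", OF start])
            show "?\<mu> s \<le> horizon T" using k by simp
          next
            fix s assume s: "emit_inv k W s" and "bval emit_guard s"
            then have "nats s 1 0 < k" by (simp add: emit_guard_def emit_inv_def)
            then show "runs emit s (max_cost emit) (\<lambda>s'. emit_inv k W s' \<and> ?\<mu> s' < ?\<mu> s)"
              using emit_step[OF s] by (intro runs_loop_free) (auto simp: emit_def)
          qed
          then show "runs (While emit_guard emit) s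
              (horizon T * (bcost emit_guard + max_cost emit) + bcost emit_guard)
              (\<lambda>s'. emit_inv k W s' \<and> k \<le> nats s' 1 0)"
            by (elim runs_weaken) (auto simp: emit_guard_def emit_inv_def)
        next
          fix s assume s: "emit_inv k W s \<and> k \<le> nats s 1 0"
          let ?s = "effect finish s"
          \<comment> \<open>Cell \<open>k\<close> is the exceptional case of \<open>tight\<close>,
            written by \<open>finish\<close> from register 7.\<close>
          have out: "output_steps ?s = k" "\<And>i. 1 \<le> i \<Longrightarrow> i \<le> k \<Longrightarrow> output_strategy ?s i = tight k W i"
            using s by (auto simp: finish_def emit_inv_def output_steps_def output_strategy_def tight_def)
          have "clearance m k (output_strategy ?s) = W * rate k"
            using clearance_cong[OF k(1) out(2)] clearance_tight[OF k(1)] by simp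
          then have "optimal_strategy m \<rho> T (output_steps ?s) (output_strategy ?s)"
            using feasible_cong[of k "output_strategy ?s", OF out(2)] feas opt best
            by (simp add: optimal_strategy_def out(1))
          then show "runs finish s (max_cost finish)
              (\<lambda>s. optimal_strategy m \<rho> T (output_steps s) (output_strategy s))"
            by (intro runs_loop_free) (auto simp: finish_def)
        qed
      qed
    qed
  qed
qed

text \<open>Rounding up at most doubles a number that is at least 1, and the outer logarithm is at
  least 1 because its argument is at least 2.\<close>

lemma linear_le_time_bound:
  assumes "0 \<le> T"
  shows "real (horizon T) \<le> 2 * time_bound m T" "1 \<le> time_bound m T"
proof -
  define L where "L = real m * log 2 (max T 2)"
  have log: "1 \<le> log 2 (max T 2)" using log_le_cancel_iff[of 2 2 "max T 2"] by simp
  have "2 * 1 \<le> L" unfolding L_def using log two_le_m by (intro mult_mono) auto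
  then have L: "2 \<le> L" by simp
  then have "1 \<le> log 2 L" using log_le_cancel_iff[of 2 2 L] by simp
  then have "L * 1 \<le> L * log 2 L" using L by (intro mult_left_mono) auto
  then have tb: "L \<le> time_bound m T" by (simp add: time_bound_def L_def Let_def)
  then show "1 \<le> time_bound m T" using L by simp
  have "real (nat \<lceil>log 2 (max T 2)\<rceil>) \<le> 2 * log 2 (max T 2)" using log by linarith
  then have "real m * real (nat \<lceil>log 2 (max T 2)\<rceil>) \<le> real m * (2 * log 2 (max T 2))"
    by (intro mult_left_mono) auto
  then show "real (horizon T) \<le> 2 * time_bound m T" using tb by (simp add: horizon_def L_def)
qed

end

theorem theorem3:
  shows "\<exists>(prog :: com) (C :: real). \<forall>(m :: nat) (\<rho> :: real) (T :: real).
           m \<ge> 2 \<longrightarrow> \<rho> \<ge> real m ^ m / real (m - 1) ^ (m - 1) \<longrightarrow> T \<ge> 0 \<longrightarrow>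
           (\<exists>t s. exec prog (input m \<rho> T) t s \<and>
                  optimal_strategy m \<rho> T (output_steps s) (output_strategy s) \<and>
                  real t \<le> C * time_bound m T)"
proof -
  \<comment> \<open>\<open>a\<close> collects what is paid once, including the extra scan pass from
    \<open>Suc\<close>; \<open>b\<close> is the cost per unit of the horizon. The
    \<open>2 * m\<close> filling passes fall under \<open>b\<close> since
    \<open>m \<le> horizon T\<close>.\<close>
  define a where "a = max_cost initialise + bcost fill_guard + bcost scan_guard
    + (bcost scan_guard + max_cost (extend ;; examine))
    + max_cost (set_nreg 1 (NConst 1)) + bcost emit_guard + max_cost finish"
  define b where "b = 2 * (bcost fill_guard + max_cost extend)
    + (bcost scan_guard + max_cost (extend ;; examine)) + (bcost emit_guard + max_cost emit)"
  have "\<exists>t s. exec clear_star (input m \<rho> T) t s \<and>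
      optimal_strategy m \<rho> T (output_steps s) (output_strategy s) \<and>
      real t \<le> (real a + 2 * real b) * time_bound m T"
    if "m \<ge> 2" "\<rho> \<ge> real m ^ m / real (m - 1) ^ (m - 1)" "T \<ge> 0" for m \<rho> T
  proof -
    interpret star m \<rho> using that by unfold_locales
    let ?h = "horizon T"
    have "2 * m * (bcost fill_guard + max_cost extend) \<le>
        ?h * (2 * (bcost fill_guard + max_cost extend))"
      using mult_le_mono1[OF horizon_ge[of T], of "2 * (bcost fill_guard + max_cost extend)"]
      by (simp add: mult_ac)
    then have "runs clear_star (input m \<rho> T) (a + ?h * b)
        (\<lambda>s. optimal_strategy m \<rho> T (output_steps s) (output_strategy s))"
      by (intro runs_weaken[OF clear_star_runs[OF that(3)]])
        (simp_all add: a_def b_def add_mult_distrib2 del: max_cost.simps)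
    then obtain t s where t: "exec clear_star (input m \<rho> T) t s"
      "optimal_strategy m \<rho> T (output_steps s) (output_strategy s)" "t \<le> a + ?h * b"
      unfolding runs_def by blast
    have "real t \<le> real a * 1 + real b * real ?h"
      using of_nat_mono[OF t(3), where 'a = real] by (simp add: mult.commute)
    also have "\<dots> \<le> real a * time_bound m T + real b * (2 * time_bound m T)"
      using linear_le_time_bound[OF that(3)] by (intro add_mono mult_left_mono) auto
    also have "\<dots> = (real a + 2 * real b) * time_bound m T" by (simp add: algebra_simps)
    finally show ?thesis using t by blast
  qed
  then show ?thesis by blast
qed

end
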